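(* Let $\mathbb{Q}^{\mathrm{tr}}\subset\overline{\mathbb{Q}}$ denote the field of all totally real numbers, and let $h$ denote the absolute logarithmic Weil height on $\overline{\mathbb{Q}}$. Then $$\liminf_{\alpha\in\mathbb{Q}^{\mathrm{tr}}} h(\alpha)\;\geq\;\frac{140}{3}\cdot\left(\frac{1}{8}-\frac{1}{6\pi}\right)^2 = 0.241573\ldots$$
   Context: An algebraic number $\alpha\in\overline{\mathbb{Q}}$ is totally real if all of its Galois conjugates over $\mathbb{Q}$ lie in $\mathbb{R}$ under any choice of embedding $\overline{\mathbb{Q}}\hookrightarrow\mathbb{C}$; the totally real numbers form a field $\mathbb{Q}^{\mathrm{tr}}$ (not only algebraic integers are considered). The absolute logarithmic Weil height $h$ is the standard one: if $\alpha\in\overline{\mathbb{Q}}$ has minimal polynomial $a_d\prod_{i=1}^d(x-\alpha_i)\in\mathbb{Z}[x]$ (primitive, irreducible, degree $d$), then $h(\alpha)=\frac{1}{d}\left(\log|a_d|+\sum_{i=1}^d\log^+|\alpha_i|\right)$, where $\log^+ t=\max(\log t,0)$ for $t>0$ and $\log^+0=0$. The limit infimum over the countably infinite set $\mathbb{Q}^{\mathrm{tr}}$ is the limit infimum of $h(\alpha)$ as $\alpha$ ranges over all elements of the set, each counted once; that is, $\liminf_{\alpha\in\mathbb{Q}^{\mathrm{tr}}}h(\alpha)\ge C$ means that for every real $\varepsilon>0$ the set $\{\alpha\in\mathbb{Q}^{\mathrm{tr}}: h(\alpha)<C-\varepsilon\}$ is finite. *)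

theory Defs
  imports "HOL-Analysis.Analysis" "HOL-Computational_Algebra.Polynomial_Factorial"
begin

text \<open>
  The algebraic closure of the rationals is realised as the set of all \<^term>\<open>x :: complex\<close>
  with \<^prop>\<open>algebraic x\<close>.
\<close>

text \<open>
  The positive leading coefficient only serves to select one of the two primitive irreducible
  integer polynomials that vanish at \<open>x\<close>.
\<close>

definition is_min_int_poly :: "complex \<Rightarrow> int poly \<Rightarrow> bool" where
  "is_min_int_poly x p \<longleftrightarrow>
     irreducible p \<and> Polynomial.content p = 1 \<and> lead_coeff p > 0 \<and> poly (map_poly of_int p) x = 0"

definition min_int_poly :: "complex \<Rightarrow> int poly" where
  "min_int_poly x = (THE p. is_min_int_poly x p)"

definition conjugates :: "complex \<Rightarrow> complex multiset" where
  "conjugates x = proots (map_poly of_int (min_int_poly x))"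

definition totally_real :: "complex \<Rightarrow> bool" where
  "totally_real x \<longleftrightarrow> algebraic x \<and> set_mset (conjugates x) \<subseteq> \<real>"

definition Q_tr :: "complex set" where
  "Q_tr = {x. totally_real x}"

definition log_plus :: "real \<Rightarrow> real" where
  "log_plus t = (if t > 0 then max (ln t) 0 else 0)"

definition weil_height :: "complex \<Rightarrow> real" where
  "weil_height x =
     1 / real (degree (min_int_poly x)) *
       (ln \<bar>real_of_int (lead_coeff (min_int_poly x))\<bar>
         + (\<Sum>y\<in>#conjugates x. log_plus (cmod y)))"

text \<open>The limit inferior over all elements of a set, each of them counted once.\<close>

definition Liminf_over :: "'a set \<Rightarrow> ('a \<Rightarrow> real) \<Rightarrow> ereal" where
  "Liminf_over A f = Liminf (inf cofinite (principal A)) (\<lambda>a. ereal (f a))"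

lemma le_Liminf_over_iff:
  "ereal C \<le> Liminf_over A f \<longleftrightarrow> (\<forall>\<epsilon>>0. finite {a \<in> A. f a < C - \<epsilon>})"
proof -
  have ev: "eventually P (inf cofinite (principal A)) \<longleftrightarrow> finite {a \<in> A. \<not> P a}" for P
    by (simp add: eventually_inf_principal eventually_cofinite)
  show ?thesis
  proof
    assume L: "ereal C \<le> Liminf_over A f"
    show "\<forall>\<epsilon>>0. finite {a \<in> A. f a < C - \<epsilon>}"
    proof (intro allI impI)
      fix \<epsilon> :: real assume "\<epsilon> > 0"
      hence "ereal (C - \<epsilon>) < ereal C" by simp
      with L have "finite {a \<in> A. \<not> ereal (C - \<epsilon>) < ereal (f a)}"
        unfolding Liminf_over_def le_Liminf_iff ev by blast
      thus "finite {a \<in> A. f a < C - \<epsilon>}"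
        by (rule rev_finite_subset) auto
    qed
  next
    assume R: "\<forall>\<epsilon>>0. finite {a \<in> A. f a < C - \<epsilon>}"
    show "ereal C \<le> Liminf_over A f"
      unfolding Liminf_over_def le_Liminf_iff ev
    proof (intro allI impI)
      fix y assume y: "y < ereal C"
      show "finite {a \<in> A. \<not> y < ereal (f a)}"
      proof (cases y)
        case (real r)
        with y have "r < C" by simp
        hence "finite {a \<in> A. f a < C - (C - r) / 2}"
          using R by simp
        thus ?thesis
          by (rule rev_finite_subset) (use real \<open>r < C\<close> in \<open>auto simp: field_simps\<close>)
      qed (use y in auto)
    qed
  qed
qed

lemma of_int_poly_eval_add:
  "poly (map_poly of_int (p + q)) (x :: complex) =
     poly (map_poly of_int p) x + poly (map_poly of_int q) x"
proof -
  have "map_poly (of_int :: int \<Rightarrow> complex) (p + q) = map_poly of_int p + map_poly of_int q"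
    by (simp add: poly_eq_iff coeff_map_poly)
  thus ?thesis by simp
qed

lemma of_int_poly_eval_mult:
  "poly (map_poly of_int (p * q)) (x :: complex) =
     poly (map_poly of_int p) x * poly (map_poly of_int q) x"
proof (induction p)
  case (pCons a p)
  have *: "map_poly (of_int :: int \<Rightarrow> complex) (smult a q) = smult (of_int a) (map_poly of_int q)"
    by (simp add: poly_eq_iff coeff_map_poly)
  show ?case
    using pCons.IH by (simp add: of_int_poly_eval_add map_poly_pCons * algebra_simps)
qed simp

lemma ex1_is_min_int_poly:
  assumes "algebraic x"
  shows "\<exists>!p. is_min_int_poly x p"
proof -
  define Z where "Z = (\<lambda>p :: int poly. poly (map_poly of_int p) x = 0)"
  have Z_mult: "Z (p * q) \<longleftrightarrow> Z p \<or> Z q" for p q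
    by (simp add: Z_def of_int_poly_eval_mult)
  have Z_const: "Z [:c:] \<longleftrightarrow> c = 0" for c
    by (simp add: Z_def map_poly_pCons)
  have deg_pos: "degree p > 0" if "Z p" "p \<noteq> 0" for p
    using that by (cases "degree p = 0") (auto elim!: degree_eq_zeroE simp: Z_const)
  from assms obtain p0 where "p0 \<noteq> 0" "Z p0"
    unfolding Z_def by (rule algebraicE') blast
  hence "\<exists>p. (p \<noteq> 0 \<and> Z p) \<and> (\<forall>q. q \<noteq> 0 \<and> Z q \<longrightarrow> degree p \<le> degree q)"
    by (intro ex_has_least_nat[of _ p0]) auto
  then obtain p1 where p1: "p1 \<noteq> 0" "Z p1" and least: "\<And>q. q \<noteq> 0 \<Longrightarrow> Z q \<Longrightarrow> degree p1 \<le> degree q"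
    by blast
  define p where "p = smult (sgn (lead_coeff p1)) (primitive_part p1)"
  have lc: "lead_coeff p1 = Polynomial.content p1 * lead_coeff (primitive_part p1)"
    by (metis content_times_primitive_part lead_coeff_smult)
  have cpos: "Polynomial.content p1 > 0"
    using p1(1) by (metis content_eq_zero_iff normalize_content normalize_int_def zero_less_abs_iff)
  have sg: "sgn (lead_coeff p1) = sgn (lead_coeff (primitive_part p1))"
    using cpos by (subst lc) (simp add: sgn_mult)
  have sg1: "sgn (lead_coeff p1) \<in> {1, -1}"
    using p1(1) by (auto simp: sgn_if)
  have p_nz: "p \<noteq> 0"
    using p1(1) by (auto simp: p_def sgn_if)
  have p_prim: "Polynomial.content p = 1"
    using sg1 p1(1) by (auto simp: p_def)
  have p_lead: "lead_coeff p > 0"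
  proof -
    have "lead_coeff p = \<bar>lead_coeff (primitive_part p1)\<bar>"
      unfolding p_def sg lead_coeff_smult by (simp add: sgn_mult_abs mult.commute abs_sgn)
    thus ?thesis using p1(1)
      by (simp add: leading_coeff_0_iff del: degree_primitive_part)
  qed
  have "Z (primitive_part p1)"
    using p1 Z_mult[of "[:Polynomial.content p1:]" "primitive_part p1"]
    by (simp add: Z_const)
  hence p_root: "Z p"
    using Z_mult[of "[:sgn (lead_coeff p1):]" "primitive_part p1"]
    by (simp add: p_def)
  have p_deg: "degree p = degree p1"
    using sg1 by (auto simp: p_def)
  have aux: "b dvd 1" if "p = a * b" "Z a" for a b
  proof -
    from that p_nz have "a \<noteq> 0" "b \<noteq> 0" by auto
    with that least[of a] have "degree b = 0"
      by (simp add: p_deg[symmetric] degree_mult_eq)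
    then obtain c where b: "b = [:c:]" by (rule degree_eq_zeroE)
    have "c dvd Polynomial.content p"
      unfolding that(1) b by simp
    thus ?thesis by (simp add: p_prim b is_unit_const_poly_iff)
  qed
  have p_irr: "irreducible p"
  proof (rule irreducibleI)
    show "\<not> p dvd 1"
      using deg_pos[OF p_root p_nz] by (auto simp: is_unit_poly_iff)
    show "a dvd 1 \<or> b dvd 1" if "p = a * b" for a b
      using aux[of a b] aux[of b a] that p_root by (auto simp: Z_mult mult.commute)
  qed (fact p_nz)
  have "is_min_int_poly x p"
    using p_irr p_prim p_lead p_root unfolding is_min_int_poly_def Z_def by blast
  moreover have "q = p" if q: "is_min_int_poly x q" for q
  proof -
    from q have q_irr: "irreducible q" and q_root: "Z q" and q_lead: "lead_coeff q > 0"
      by (auto simp: is_min_int_poly_def Z_def)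
    define r where "r = pseudo_mod q p"
    obtain a s where as: "a \<noteq> 0" "smult a q = p * s + r" and r: "r = 0 \<or> degree r < degree p"
      using pseudo_mod[OF p_nz, of q] unfolding r_def by blast
    have "r = [:a:] * q + [:-1:] * (p * s)"
      using as(2) by (simp add: algebra_simps)
    hence "Z r"
      using q_root p_root
      by (simp add: Z_def of_int_poly_eval_add of_int_poly_eval_mult del: mult_pCons_left)
    with r least[of r] have "r = 0" unfolding p_deg by linarith
    with as have "p dvd [:a:] * q" by simp
    moreover have "prime_elem p"
      using p_irr by (rule irreducible_imp_prime_elem)
    ultimately have "p dvd [:a:] \<or> p dvd q" by (simp add: prime_elem_dvd_mult_iff del: mult_pCons_left)
    moreover have "\<not> p dvd [:a:]"
      using deg_pos[OF p_root p_nz] as(1) dvd_imp_degree_le[of p "[:a:]"] by auto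
    ultimately obtain u where u: "q = p * u" by blast
    with q_irr p_irr have "u dvd 1"
      by (meson irreducibleD irreducible_not_unit)
    then obtain c where c: "u = [:c:]" "c dvd 1" by (auto simp: is_unit_poly_iff)
    have "c > 0"
      using q_lead p_lead by (auto simp: u c(1) lead_coeff_mult zero_less_mult_iff split: if_splits)
    with c(2) have "c = 1" by simp
    thus "q = p" by (simp add: u c)
  qed
  ultimately show ?thesis by blast
qed

lemma is_min_int_poly_min_int_poly: "algebraic x \<Longrightarrow> is_min_int_poly x (min_int_poly x)"
  unfolding min_int_poly_def by (rule theI') (rule ex1_is_min_int_poly)

end

theory Submission
  imports Defs "HOL-Computational_Algebra.Fundamental_Theorem_Algebra"
begin

text \<open>
  The argument is an auxiliary-function argument in the style of Smyth. If \<open>q\<close> is a monic integer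
  polynomial of degree \<open>k\<close> and \<open>p\<close> is the minimal integer polynomial of \<open>x\<close>, with leading
  coefficient \<open>a\<close> and not vanishing at any root of \<open>q\<close>, then \<open>a ^ k\<close> times the product of \<open>q\<close> over the
  conjugates of \<open>x\<close> is a nonzero integer up to sign (a resultant), so the sum of \<open>ln \<bar>q\<bar>\<close> over
  the conjugates is at least \<open>- k * ln a\<close>. Every real \<open>y\<close> satisfies, away from the singularities,
  \<open>42 log\<^sup>+ \<bar>y\<bar> \<ge> 103/10 + 10 ln \<bar>y\<bar> + 9 ln \<bar>y\<^sup>2 - 1\<bar> + ln \<bar>y\<^sup>2 - y - 1\<bar> + ln \<bar>y\<^sup>2 + y - 1\<bar>\<close>,
  and \<open>10 + 9 * 2 + 2 + 2 = 32 \<le> 42\<close>. Summing over the conjugates of a totally real number gives height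
  at least \<open>103/420 > 0.24524\<close>, unless the number is conjugate to a root of one of the four
  polynomials; this excludes only finitely many numbers.
\<close>

section \<open>The auxiliary function\<close>

lemma ln_le_tangent:
  fixes x c :: real
  assumes "x > 0" "c > 0"
  shows "ln x \<le> ln c + (x / c - 1)"
  using ln_le_minus_one[of "x / c"] assms by (simp add: ln_div)

text \<open>The left-hand side is minus the value of
  \<open>5 * ln s + 9 * ln (1 - s) + ln (1 - 3 * s + s\<^sup>2)\<close> at s = 1/4. Doubling and
  exponentiating reduces the bound to rational arithmetic with e < 2.72.\<close>

lemma ln_tangent_point_bound: "32 * ln 2 - 9 * ln 3 - ln 5 \<ge> (21 / 2 :: real)"
proof -
  have ln_frac: "ln (a / (b * c)) = ln a - (ln b + ln c)" if "a > 0" "b > 0" "c > 0"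
    for a b c :: real
    using that by (simp add: ln_div ln_mult_pos)
  have "exp (21 :: real) = exp 1 ^ 21"
    by (simp flip: exp_of_nat_mult)
  also have "\<dots> \<le> (272 / 100) ^ 21"
    using e_less_272 by (intro power_mono) auto
  also have "\<dots> \<le> 2 ^ 64 / (3 ^ 18 * 5 ^ 2)"
    by (simp add: field_simps)
  finally have "21 \<le> ln (2 ^ 64 / (3 ^ 18 * 5 ^ 2) :: real)"
    by (simp add: ln_ge_iff)
  also have "\<dots> = ln (2 ^ 64) - (ln (3 ^ 18) + ln (5 ^ 2))"
    by (rule ln_frac) simp_all
  also have "\<dots> = 64 * ln 2 - (18 * ln 3 + 2 * ln (5::real))"
    by (simp only: ln_realpow)
  finally show ?thesis by simp
qed

text \<open>The two local maxima of the left-hand side are at \<open>s = 1/4\<close> and \<open>s = 1/2\<close>.\<close>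

lemma ln_sum_le:
  fixes s :: real
  assumes s: "0 < s" "s < 1" and nz: "1 - 3 * s + s\<^sup>2 \<noteq> 0"
  shows "5 * ln s + 9 * ln (1 - s) + ln \<bar>1 - 3 * s + s\<^sup>2\<bar> \<le> - (103 / 10)"
proof (cases "1 - 3 * s + s\<^sup>2 > 0")
  case True
  \<comment> \<open>On (0, 1) positivity even forces s < (3 - sqrt 5) / 2; the rounder 1/2 is the
    nonzero root of the quadratic in \<open>quad\<close>.\<close>
  have "s < 1 / 2"
  proof (rule ccontr)
    assume "\<not> s < 1 / 2"
    hence "(s - 1 / 2) * (s - 5 / 2) \<le> 0"
      using s by (intro mult_nonneg_nonpos) auto
    moreover have "(s - 1 / 2) * (s - 5 / 2) = 1 - 3 * s + s\<^sup>2 + 1 / 4"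
      by (simp add: power2_eq_square field_simps)
    ultimately show False using True by linarith
  qed
  hence "16 / 5 * s * (1 / 2 - s) \<ge> 0" using s by simp
  hence quad: "16 / 5 * s\<^sup>2 - 8 / 5 * s \<le> 0"
    by (simp add: power2_eq_square algebra_simps)
  \<comment> \<open>Tangents at s = 1/4. With weights 5, 9, 1 their corrections add up to 16/5 s^2 -
    8/5 s + 1/5, which is at most 1/5; this loss turns 21/2 into 103/10.\<close>
  have t: "ln s \<le> ln (1 / 4) + (4 * s - 1)"
    "ln (1 - s) \<le> ln (3 / 4) + (4 / 3 * (1 - s) - 1)"
    "ln (1 - 3 * s + s\<^sup>2) \<le> ln (5 / 16) + (16 / 5 * (1 - 3 * s + s\<^sup>2) - 1)"
    using ln_le_tangent[of s "1 / 4"] ln_le_tangent[of "1 - s" "3 / 4"]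
      ln_le_tangent[of "1 - 3 * s + s\<^sup>2" "5 / 16"] s True
    by (simp_all add: mult.commute)
  have l: "ln (1 / 4 :: real) = - 2 * ln 2" "ln (3 / 4 :: real) = ln 3 - 2 * ln 2"
    "ln (5 / 16 :: real) = ln 5 - 4 * ln 2"
    using ln_realpow[of 2 2] ln_realpow[of 2 4] by (simp_all add: ln_div)
  have "5 * ln s + 9 * ln (1 - s) + ln (1 - 3 * s + s\<^sup>2) \<le> - (103 / 10)"
    using t[unfolded l] quad ln_tangent_point_bound by argo
  thus ?thesis using True by simp
next
  case False
  with nz have neg: "1 - 3 * s + s\<^sup>2 < 0" by simp
  have "(2 * s - 1)\<^sup>2 \<ge> 0" by simp
  hence quad: "4 * s - 1 - 4 * s\<^sup>2 \<le> 0"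
    by (simp add: power2_eq_square algebra_simps)
  \<comment> \<open>Tangents at s = 1/2. The weighted corrections add up to -(2s - 1)^2, and the
    value there is -16 ln 2, at most -32/3.\<close>
  have t: "ln s \<le> ln (1 / 2) + (2 * s - 1)"
    "ln (1 - s) \<le> ln (1 / 2) + (2 * (1 - s) - 1)"
    "ln (- (1 - 3 * s + s\<^sup>2)) \<le> ln (1 / 4) + (4 * (- (1 - 3 * s + s\<^sup>2)) - 1)"
    using ln_le_tangent[of s "1 / 2"] ln_le_tangent[of "1 - s" "1 / 2"]
      ln_le_tangent[of "- (1 - 3 * s + s\<^sup>2)" "1 / 4"] s neg
    by (simp_all add: mult.commute)
  have l: "ln (1 / 2 :: real) = - ln 2" "ln (1 / 4 :: real) = - 2 * ln 2"
    using ln_realpow[of 2 2] by (simp_all add: ln_div)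
  have "5 * ln s + 9 * ln (1 - s) + ln (- (1 - 3 * s + s\<^sup>2)) \<le> - (103 / 10)"
    using t[unfolded l] quad ln2_ge_two_thirds by argo
  thus ?thesis using neg by simp
qed

text \<open>The factor 42 = 2 * 10 + 9 * 2 + 4 makes the difference of the two sides invariant under
  z -> 1/z. Hence s = 1/z^2 for |z| > 1 and s = z^2 otherwise both lead to
  \<open>ln_sum_le\<close>.\<close>

lemma log_plus_ge_auxiliary:
  fixes z :: real
  assumes nz: "z \<noteq> 0" "z\<^sup>2 \<noteq> 1" "z ^ 4 - 3 * z\<^sup>2 + 1 \<noteq> 0"
  shows "103 / 10 + 10 * ln \<bar>z\<bar> + 9 * ln \<bar>z\<^sup>2 - 1\<bar> + ln \<bar>z ^ 4 - 3 * z\<^sup>2 + 1\<bar>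
           \<le> 42 * log_plus \<bar>z\<bar>"
proof (cases "\<bar>z\<bar> > 1")
  case True
  define s where "s = 1 / z\<^sup>2"
  have z2: "z\<^sup>2 > 1" using True by (metis one_less_power power2_abs zero_less_numeral)
  have s: "0 < s" "s < 1" using z2 by (auto simp: s_def divide_simps)
  have e: "1 - s = (z\<^sup>2 - 1) / z\<^sup>2" "1 - 3 * s + s\<^sup>2 = (z ^ 4 - 3 * z\<^sup>2 + 1) / z ^ 4"
    using nz by (auto simp: s_def field_simps)
  have "ln s = - 2 * ln \<bar>z\<bar>"
    using nz ln_realpow[of "\<bar>z\<bar>" 2] by (simp add: s_def ln_div)
  moreover have "ln (1 - s) = ln \<bar>z\<^sup>2 - 1\<bar> - 2 * ln \<bar>z\<bar>"
    using nz z2 ln_realpow[of "\<bar>z\<bar>" 2] unfolding e by (simp add: ln_div)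
  moreover have "ln \<bar>1 - 3 * s + s\<^sup>2\<bar> = ln \<bar>z ^ 4 - 3 * z\<^sup>2 + 1\<bar> - 4 * ln \<bar>z\<bar>"
    using nz ln_realpow[of "\<bar>z\<bar>" 4] unfolding e by (simp add: abs_divide ln_div)
  moreover have "log_plus \<bar>z\<bar> = ln \<bar>z\<bar>"
    using True by (simp add: log_plus_def)
  moreover have "1 - 3 * s + s\<^sup>2 \<noteq> 0" unfolding e using nz by simp
  ultimately show ?thesis using ln_sum_le[OF s] by simp
next
  case False
  hence "z\<^sup>2 \<le> 1" by (simp add: abs_square_le_1)
  hence s: "0 < z\<^sup>2" "z\<^sup>2 < 1" using nz by auto
  have e: "1 - 3 * z\<^sup>2 + (z\<^sup>2)\<^sup>2 = z ^ 4 - 3 * z\<^sup>2 + 1" by simp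
  have "ln (z\<^sup>2) = 2 * ln \<bar>z\<bar>"
    using nz ln_realpow[of "\<bar>z\<bar>" 2] by simp
  moreover have "\<bar>z\<^sup>2 - 1\<bar> = 1 - z\<^sup>2" using s by simp
  moreover have "log_plus \<bar>z\<bar> = 0"
    using False nz by (auto simp: log_plus_def max_def)
  ultimately show ?thesis using ln_sum_le[OF s] nz unfolding e by simp
qed

section \<open>Resultants with small polynomials\<close>

abbreviation cpoly :: "int poly \<Rightarrow> complex poly" where
  "cpoly \<equiv> map_poly of_int"

text \<open>
  If \<open>r\<close> and \<open>r'\<close> are the roots of a monic integer quadratic, the values of an integer polynomial at
  them are \<open>m + n r\<close> and \<open>m + n r'\<close> with the same integers \<open>m\<close> and \<open>n\<close>.
\<close>

lemma cpoly_quadratic_mult_Ints: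
  fixes r r' :: complex and p :: "int poly"
  assumes "r + r' = of_int s" "r * r' = of_int t"
  shows "poly (cpoly p) r * poly (cpoly p) r' \<in> \<int>"
proof -
  have r': "r' = of_int s - r" using assms(1) by (simp add: algebra_simps)
  have sq: "r * r = of_int s * r - of_int t"
    using assms(2) by (simp add: r' algebra_simps)
  have sq': "r' * r' = of_int s * r' - of_int t"
    using sq by (simp add: r' algebra_simps)
  have "\<exists>m n. poly (cpoly p) r = of_int m + of_int n * r \<and>
              poly (cpoly p) r' = of_int m + of_int n * r'"
  proof (induction p)
    case 0
    show ?case by (intro exI[of _ 0]) simp
  next
    case (pCons a p)
    then obtain m n where IH: "poly (cpoly p) r = of_int m + of_int n * r"
      "poly (cpoly p) r' = of_int m + of_int n * r'" by blast
    \<comment> \<open>One Horner step, for either root, so that both receive the same new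
      integers.\<close>
    have step: "poly (cpoly (pCons a p)) q = of_int (a - n * t) + of_int (m + n * s) * q"
      if "q * q = of_int s * q - of_int t" "poly (cpoly p) q = of_int m + of_int n * q" for q
    proof -
      have "poly (cpoly (pCons a p)) q = of_int a + of_int m * q + of_int n * (q * q)"
        using that(2) by (simp add: map_poly_pCons algebra_simps)
      thus ?thesis unfolding that(1) by (simp add: algebra_simps)
    qed
    show ?case using step[OF sq IH(1)] step[OF sq' IH(2)] by blast
  qed
  then obtain m n where "poly (cpoly p) r = of_int m + of_int n * r"
    "poly (cpoly p) r' = of_int m + of_int n * r'" by blast
  hence "poly (cpoly p) r * poly (cpoly p) r' =
      of_int m * of_int m + of_int m * of_int n * (r + r') + of_int n * of_int n * (r * r')"
    by (simp add: algebra_simps)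
  also have "\<dots> = of_int (m * m + m * n * s + n * n * t)"
    unfolding assms by simp
  finally show ?thesis by simp
qed

lemma one_le_cmod_Ints: "1 \<le> cmod z" if "z \<in> \<int>" "z \<noteq> 0"
  using that by (elim Ints_cases) (auto simp flip: of_int_abs)

lemma ln_prod_mset:
  fixes f :: "'a \<Rightarrow> real"
  assumes "\<And>y. y \<in># A \<Longrightarrow> f y > 0"
  shows "(\<Prod>y\<in>#A. f y) > 0 \<and> ln (\<Prod>y\<in>#A. f y) = (\<Sum>y\<in>#A. ln (f y))"
  using assms by (induction A) (auto simp: ln_mult_pos)

lemma cmod_prod_mset: "cmod (\<Prod>y\<in>#A. f y) = (\<Prod>y\<in>#A. cmod (f y))"
  by (induction A) (auto simp: norm_mult)

lemma ln_cmod_mult: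
  "ln (cmod (a * b)) = ln (cmod a) + ln (cmod b)" if "a \<noteq> 0" "b \<noteq> 0"
  using that by (simp add: norm_mult ln_mult_pos)

text \<open>Take logarithms in the factorisation over the complex roots; no factor vanishes, since a
  conjugate equal to \<open>r\<close> would be a zero of the polynomial at \<open>r\<close>.\<close>

lemma ln_cmod_poly_conjugates:
  assumes "algebraic x" and nz: "poly (cpoly (min_int_poly x)) r \<noteq> 0"
  shows "ln (cmod (poly (cpoly (min_int_poly x)) r)) =
           ln (real_of_int (lead_coeff (min_int_poly x))) + (\<Sum>y\<in>#conjugates x. ln (cmod (r - y)))"
proof -
  define p where "p = min_int_poly x"
  have lc: "lead_coeff p > 0"
    using is_min_int_poly_min_int_poly[OF assms(1)] by (simp add: is_min_int_poly_def p_def)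
  have "lead_coeff (cpoly p) = of_int (lead_coeff p)"
    by (simp add: coeff_map_poly degree_map_poly)
  hence "poly (cpoly p) r = of_int (lead_coeff p) * (\<Prod>y\<in>#conjugates x. r - y)"
    by (subst complex_poly_decompose_multiset[symmetric])
      (simp add: poly_prod_mset conjugates_def p_def)
  hence eq: "cmod (poly (cpoly p) r) =
      real_of_int (lead_coeff p) * (\<Prod>y\<in>#conjugates x. cmod (r - y))"
    using lc by (simp add: norm_mult cmod_prod_mset)
  have "cmod (r - y) > 0" if "y \<in># conjugates x" for y
  proof -
    have "poly (cpoly p) y = 0"
      using that by (cases "cpoly p = 0") (auto simp: conjugates_def p_def)
    thus ?thesis using nz by (auto simp: p_def)
  qed
  from ln_prod_mset[of _ "\<lambda>y. cmod (r - y)", OF this] lc show ?thesis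
    by (simp add: eq flip: p_def) (simp add: ln_mult_pos)
qed

text \<open>The product of the two values is, up to sign, the resultant with X^2 - sX + t: a nonzero
  integer, hence of modulus at least 1. Each value contributes one leading coefficient.\<close>

lemma ln_quadratic_conjugates_ge:
  assumes alg: "algebraic x"
    and r: "r + r' = of_int s" "r * r' = of_int t"
    and nz: "poly (cpoly (min_int_poly x)) r \<noteq> 0" "poly (cpoly (min_int_poly x)) r' \<noteq> 0"
  shows "0 \<le> 2 * ln (real_of_int (lead_coeff (min_int_poly x)))
              + (\<Sum>y\<in>#conjugates x. ln (cmod (r - y)) + ln (cmod (r' - y)))"
proof -
  let ?P = "poly (cpoly (min_int_poly x))"
  have "1 \<le> cmod (?P r * ?P r')"
    using nz by (intro one_le_cmod_Ints cpoly_quadratic_mult_Ints[OF r]) auto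
  hence "0 \<le> ln (cmod (?P r * ?P r'))" by simp
  also have "\<dots> = ln (cmod (?P r)) + ln (cmod (?P r'))"
    by (rule ln_cmod_mult[OF nz])
  finally show ?thesis
    using ln_cmod_poly_conjugates[OF alg nz(1)] ln_cmod_poly_conjugates[OF alg nz(2)]
    by (simp add: sum_mset.distrib)
qed

lemma ln_conjugates_ge:
  assumes alg: "algebraic x" and nz: "poly (cpoly (min_int_poly x)) 0 \<noteq> 0"
  shows "0 \<le> ln (real_of_int (lead_coeff (min_int_poly x))) + (\<Sum>y\<in>#conjugates x. ln (cmod y))"
  \<comment> \<open>The quadratic X^2, with double root 0, gives twice the claim.\<close>
  using ln_quadratic_conjugates_ge[of x 0 0 0 0] assms
  by (simp flip: sum_mset_distrib_left)

section \<open>The height bound\<close>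

definition golden :: complex where
  "golden = of_real ((1 + sqrt 5) / 2)"

lemma golden_sq: "golden * golden = golden + 1"
proof -
  have "(1 + sqrt 5) / 2 * ((1 + sqrt 5) / 2) = (1 + sqrt 5) / 2 + 1"
    by (simp add: field_simps)
  hence "complex_of_real ((1 + sqrt 5) / 2 * ((1 + sqrt 5) / 2))
      = of_real ((1 + sqrt 5) / 2 + 1)"
    by (rule arg_cong)
  thus ?thesis unfolding of_real_mult of_real_add[of _ 1] of_real_1 golden_def .
qed

text \<open>The roots of X, X^2 - 1, X^2 - X - 1 and X^2 + X - 1.\<close>

definition aux_roots :: "complex set" where
  "aux_roots = {0, 1, -1, golden, 1 - golden, - golden, golden - 1}"

text \<open>The real inequality with its quadratics split into linear factors, paired as
  \<open>ln_quadratic_conjugates_ge\<close> expects.\<close>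

lemma log_plus_ge_auxiliary_complex:
  assumes "y \<in> \<real>" and "y \<notin> aux_roots"
  shows "103 / 10 + 10 * ln (cmod y) + 9 * (ln (cmod (1 - y)) + ln (cmod (- 1 - y)))
           + (ln (cmod (golden - y)) + ln (cmod (1 - golden - y)))
           + (ln (cmod (- golden - y)) + ln (cmod (golden - 1 - y)))
         \<le> 42 * log_plus (cmod y)"
proof -
  obtain z where z: "y = of_real z" using assms(1) by (auto elim: Reals_cases)
  have nz: "y \<noteq> 0" "1 - y \<noteq> 0" "- 1 - y \<noteq> 0" "golden - y \<noteq> 0" "1 - golden - y \<noteq> 0"
    "- golden - y \<noteq> 0" "golden - 1 - y \<noteq> 0"
    using assms(2) by (auto simp: aux_roots_def)
  have f1: "(1 - y) * (- 1 - y) = of_real (z\<^sup>2 - 1)"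
    by (simp add: z algebra_simps power2_eq_square)
  have gold: "(golden - y) * (1 - golden - y) = y * y - y - 1"
    "(- golden - y) * (golden - 1 - y) = y * y + y - 1"
    by (simp_all add: algebra_simps golden_sq)
  have f2: "(golden - y) * (1 - golden - y) * ((- golden - y) * (golden - 1 - y))
      = of_real (z ^ 4 - 3 * z\<^sup>2 + 1)"
    unfolding gold by (simp add: z algebra_simps power2_eq_square power4_eq_xxxx)
  have "of_real (z\<^sup>2 - 1) \<noteq> (0::complex)" "of_real (z ^ 4 - 3 * z\<^sup>2 + 1) \<noteq> (0::complex)"
    unfolding f1[symmetric] f2[symmetric] by (intro no_zero_divisors nz)+
  hence nz': "z\<^sup>2 \<noteq> 1" "z ^ 4 - 3 * z\<^sup>2 + 1 \<noteq> 0"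
    by (auto simp only: of_real_eq_0_iff)
  have ln1: "ln (cmod (1 - y)) + ln (cmod (- 1 - y)) = ln \<bar>z\<^sup>2 - 1\<bar>"
    using ln_cmod_mult[OF nz(2,3)] unfolding f1 norm_of_real by (rule sym)
  have ln2: "ln (cmod (golden - y)) + ln (cmod (1 - golden - y))
      + (ln (cmod (- golden - y)) + ln (cmod (golden - 1 - y))) = ln \<bar>z ^ 4 - 3 * z\<^sup>2 + 1\<bar>"
    using ln_cmod_mult[OF no_zero_divisors[OF nz(4,5)] no_zero_divisors[OF nz(6,7)]]
    unfolding f2 norm_of_real ln_cmod_mult[OF nz(4,5)] ln_cmod_mult[OF nz(6,7)] by (rule sym)
  have "cmod y = \<bar>z\<bar>" and z0: "z \<noteq> 0" using nz(1) by (simp_all add: z)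
  thus ?thesis
    using log_plus_ge_auxiliary[OF z0 nz'] unfolding ln1[symmetric] ln2[symmetric]
    by (simp only: add.assoc)
qed

lemma weil_height_ge:
  assumes x: "totally_real x"
    and nz: "\<And>r. r \<in> aux_roots \<Longrightarrow> poly (cpoly (min_int_poly x)) r \<noteq> 0"
  shows "weil_height x \<ge> 103 / 420"
proof -
  define p where "p = min_int_poly x"
  have alg: "algebraic x" using x by (simp add: totally_real_def)
  have p: "lead_coeff p > 0" "poly (cpoly p) x = 0"
    using is_min_int_poly_min_int_poly[OF alg] by (simp_all add: is_min_int_poly_def p_def)
  have "p \<noteq> 0" using p(1) by auto
  have deg: "degree p > 0"
  proof (rule ccontr)
    assume "\<not> degree p > 0"
    then obtain c where "p = [:c:]" by (auto elim: degree_eq_zeroE)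
    thus False using p by (simp add: map_poly_pCons)
  qed
  have size: "size (conjugates x) = degree p"
    by (simp add: conjugates_def size_proots_complex degree_map_poly flip: p_def)
  define L where "L = ln (real_of_int (lead_coeff p))"
  have L: "L \<ge> 0" using p(1) by (simp add: L_def)
  define S where "S f = (\<Sum>y\<in>#conjugates x. f y)" for f :: "complex \<Rightarrow> real"
  have S_add: "S (\<lambda>y. f y + g y) = S f + S g" for f g
    by (simp add: S_def sum_mset.distrib)
  have S_cmult: "S (\<lambda>y. c * f y) = c * S f" for c f
    by (simp add: S_def sum_mset_distrib_left)
  have S_const: "S (\<lambda>_. c) = degree p * c" for c :: real
    by (simp add: S_def size)
  have ptwise: "y \<in> \<real>" "y \<notin> aux_roots" if "y \<in># conjugates x" for y
  proof -
    show "y \<in> \<real>" using x that by (auto simp: totally_real_def)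
    have "poly (cpoly p) y = 0"
      using that by (cases "cpoly p = 0") (auto simp: conjugates_def p_def)
    thus "y \<notin> aux_roots" using nz by (auto simp: p_def)
  qed
  have quad: "0 \<le> 2 * L + S (\<lambda>y. ln (cmod (r - y)) + ln (cmod (r' - y)))"
    if "r \<in> aux_roots" "r' \<in> aux_roots" "r + r' = of_int s" "r * r' = of_int t" for r r' s t
    using ln_quadratic_conjugates_ge[OF alg that(3,4) nz nz] that(1,2)
    by (simp add: L_def S_def p_def)
  have q0: "0 \<le> L + S (\<lambda>y. ln (cmod y))"
    using ln_conjugates_ge[OF alg nz] by (simp add: L_def S_def p_def aux_roots_def)
  have q1: "0 \<le> 2 * L + S (\<lambda>y. ln (cmod (1 - y)) + ln (cmod (- 1 - y)))"
    by (rule quad[of _ _ 0 "-1"]) (auto simp: aux_roots_def)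
  have q2: "0 \<le> 2 * L + S (\<lambda>y. ln (cmod (golden - y)) + ln (cmod (1 - golden - y)))"
    by (rule quad[of _ _ 1 "-1"]) (auto simp: aux_roots_def algebra_simps golden_sq)
  have q3: "0 \<le> 2 * L + S (\<lambda>y. ln (cmod (- golden - y)) + ln (cmod (golden - 1 - y)))"
    by (rule quad[of _ _ "-1" "-1"]) (auto simp: aux_roots_def algebra_simps golden_sq)
  have "S (\<lambda>y. 103 / 10 + 10 * ln (cmod y) + 9 * (ln (cmod (1 - y)) + ln (cmod (- 1 - y)))
           + (ln (cmod (golden - y)) + ln (cmod (1 - golden - y)))
           + (ln (cmod (- golden - y)) + ln (cmod (golden - 1 - y))))
        \<le> S (\<lambda>y. 42 * log_plus (cmod y))"
    unfolding S_def by (intro sum_mset_mono log_plus_ge_auxiliary_complex ptwise)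
  \<comment> \<open>Weights 10, 9, 1, 1 on \<open>q0\<close>, \<open>q1\<close>, \<open>q2\<close>,
    \<open>q3\<close> produce \<open>32 * L\<close>.\<close>
  hence "degree p * (103 / 10) \<le> 32 * L + 42 * S (\<lambda>y. log_plus (cmod y))"
    using q0 q1 q2 q3 unfolding S_add S_cmult S_const by argo
  also have "\<dots> \<le> 42 * (L + S (\<lambda>y. log_plus (cmod y)))" using L by simp
  finally have "103 / 420 * real (degree p) \<le> L + S (\<lambda>y. log_plus (cmod y))" by simp
  moreover have "weil_height x = (L + S (\<lambda>y. log_plus (cmod y))) / degree p"
    using p(1) by (simp add: weil_height_def L_def S_def flip: p_def)
  ultimately show ?thesis
    using deg by (simp add: pos_le_divide_eq)
qed

section \<open>Finiteness of the exceptional set\<close>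

text \<open>By uniqueness, a minimal polynomial vanishing at \<open>r\<close> is the minimal
  polynomial of \<open>r\<close>, so \<open>x\<close> is one of its finitely many roots. For
  transcendental \<open>r\<close> there is no such \<open>x\<close>.\<close>

lemma finite_min_int_poly_zero:
  "finite {x. algebraic x \<and> poly (cpoly (min_int_poly x)) r = 0}" (is "finite ?A")
proof (cases "algebraic r")
  case True
  note p = is_min_int_poly_min_int_poly[OF this]
  have "?A \<subseteq> {x. poly (cpoly (min_int_poly r)) x = 0}"
  proof safe
    fix x assume x: "algebraic x" "poly (cpoly (min_int_poly x)) r = 0"
    note q = is_min_int_poly_min_int_poly[OF x(1)]
    hence "is_min_int_poly r (min_int_poly x)"
      using x(2) by (simp add: is_min_int_poly_def)
    hence "min_int_poly x = min_int_poly r"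
      using p ex1_is_min_int_poly[OF True] by blast
    thus "poly (cpoly (min_int_poly r)) x = 0"
      using q by (simp add: is_min_int_poly_def)
  qed
  moreover have "cpoly (min_int_poly r) \<noteq> 0"
    using p by (auto simp: is_min_int_poly_def map_poly_eq_0_iff)
  ultimately show ?thesis
    using poly_roots_finite finite_subset by blast
next
  case False
  have "?A = {}"
  proof safe
    fix x assume x: "algebraic x" "poly (cpoly (min_int_poly x)) r = 0"
    have "min_int_poly x \<noteq> 0"
      using is_min_int_poly_min_int_poly[OF x(1)] by (auto simp: is_min_int_poly_def)
    hence "algebraic r"
      using x(2) by (intro algebraicI[of "cpoly (min_int_poly x)"])
        (auto simp: coeff_map_poly map_poly_eq_0_iff)
    with False show "x \<in> {}" by simp
  qed
  thus ?thesis by (metis finite.emptyI)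
qed

section \<open>Numerical comparison and conclusion\<close>

lemma constant_bounds:
  "0.241573 \<le> 140 / 3 * (1 / 8 - 1 / (6 * pi))\<^sup>2"
  "140 / 3 * (1 / 8 - 1 / (6 * pi))\<^sup>2 < 0.241574"
proof -
  \<comment> \<open>The base is increasing in pi and nonnegative, so rational bounds on pi carry
    over to its square.\<close>
  have lo: "1 / 8 - 1 / (6 * 3.141592653588) \<le> 1 / 8 - 1 / (6 * pi)"
    using pi_approx by (intro diff_left_mono divide_left_mono) auto
  have hi: "1 / 8 - 1 / (6 * pi) \<le> 1 / 8 - 1 / (6 * 3.1415926535899)"
    using pi_approx by (intro diff_left_mono divide_left_mono) auto
  have nonneg: "0 \<le> 1 / 8 - 1 / (6 * pi)"
    by (rule order_trans[OF _ lo]) simp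
  have "(1 / 8 - 1 / (6 * 3.141592653588))\<^sup>2 \<le> (1 / 8 - 1 / (6 * pi))\<^sup>2"
    using lo by (intro power_mono) auto
  moreover have "(1 / 8 - 1 / (6 * pi))\<^sup>2 \<le> (1 / 8 - 1 / (6 * 3.1415926535899))\<^sup>2"
    using hi nonneg by (rule power_mono)
  ultimately show "0.241573 \<le> 140 / 3 * (1 / 8 - 1 / (6 * pi))\<^sup>2"
    "140 / 3 * (1 / 8 - 1 / (6 * pi))\<^sup>2 < 0.241574"
    by (auto simp: power2_eq_square)
qed

theorem theorem1:
  shows "Liminf_over Q_tr weil_height \<ge> ereal (140 / 3 * (1 / 8 - 1 / (6 * pi))\<^sup>2)
    \<and> 0.241573 \<le> 140 / 3 * (1 / 8 - 1 / (6 * pi))\<^sup>2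
    \<and> 140 / 3 * (1 / 8 - 1 / (6 * pi))\<^sup>2 < 0.241574"
proof (intro conjI constant_bounds)
  show "ereal (140 / 3 * (1 / 8 - 1 / (6 * pi))\<^sup>2) \<le> Liminf_over Q_tr weil_height"
    unfolding le_Liminf_over_iff
  proof (intro allI impI)
    fix \<epsilon> :: real assume "\<epsilon> > 0"
    let ?E = "\<Union>r\<in>aux_roots. {x. algebraic x \<and> poly (cpoly (min_int_poly x)) r = 0}"
    have "{x \<in> Q_tr. weil_height x < 140 / 3 * (1 / 8 - 1 / (6 * pi))\<^sup>2 - \<epsilon>} \<subseteq> ?E"
    proof
      fix x assume "x \<in> {x \<in> Q_tr. weil_height x < 140 / 3 * (1 / 8 - 1 / (6 * pi))\<^sup>2 - \<epsilon>}"
      \<comment> \<open>103/420 = 0.2452... exceeds 0.241574.\<close>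
      hence x: "totally_real x" and "weil_height x < 103 / 420"
        using constant_bounds(2) \<open>\<epsilon> > 0\<close> by (auto simp: Q_tr_def)
      with weil_height_ge[OF x] have "\<exists>r\<in>aux_roots. poly (cpoly (min_int_poly x)) r = 0"
        by fastforce
      thus "x \<in> ?E" using x by (auto simp: totally_real_def)
    qed
    moreover have "finite ?E"
      using finite_min_int_poly_zero by (intro finite_UN_I) (auto simp: aux_roots_def)
    ultimately show "finite {x \<in> Q_tr. weil_height x < 140 / 3 * (1 / 8 - 1 / (6 * pi))\<^sup>2 - \<epsilon>}"
      by (rule finite_subset)
  qed
qed

end
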